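(* Let $\Omega\subset\mathbb{C}$ be a domain that satisfies Condition 1. Then, for every $p\in\partial\Omega$, $\lim_{\Omega\ni z\to p}s_\Omega(z)=1$.
   Context: Write $\mathbb{D}$ for the open unit disc in $\mathbb{C}$ and $D(p,r)$ for the open disc of radius $r$ centred at $p$. Closures and boundaries are taken in $\mathbb{C}$. Condition 1: a hyperbolic domain $\Omega\subset\mathbb{C}$ (i.e. one whose Kobayashi pseudodistance is a distance) satisfies Condition 1 if for every $p\in\partial\Omega$ there exist $r>0$ and a topological embedding $\tau_p:\overline{\mathbb{D}}\to\overline{\Omega}$ such that $\tau_p(\mathbb{D})\subset\Omega$ and $D(p,r)\cap\Omega\subset\tau_p(\mathbb{D})$. Squeezing function: for $z\in\Omega$, $s_\Omega(z)$ is the supremum of all $r\in(0,1]$ for which there is an injective holomorphic map $\phi:\Omega\to\mathbb{D}$ with $\phi(z)=0$ and $D(0,r)\subset\phi(\Omega)$. *)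

theory Defs
  imports "HOL-Complex_Analysis.Complex_Analysis"
begin

definition planar_domain :: "complex set \<Rightarrow> bool" where
  "planar_domain \<Omega> \<longleftrightarrow> open \<Omega> \<and> connected \<Omega> \<and> \<Omega> \<noteq> {}"

definition poincare_dist :: "complex \<Rightarrow> complex \<Rightarrow> real" where
  "poincare_dist a b = artanh (cmod ((a - b) / (1 - cnj b * a)))"

text \<open>Lengths of the chains of holomorphic discs in \<open>\<Omega>\<close> from \<open>z\<close> to \<open>w\<close>: the \<open>i\<close>-th disc
  \<open>f i\<close> joins \<open>p i\<close> to \<open>p (Suc i)\<close>.\<close>
definition chain_lengths :: "complex set \<Rightarrow> complex \<Rightarrow> complex \<Rightarrow> real set" where
  "chain_lengths \<Omega> z w =
    {(\<Sum>i<n. poincare_dist (a i) (b i)) |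
      (n::nat) (p :: nat \<Rightarrow> complex) (a :: nat \<Rightarrow> complex) (b :: nat \<Rightarrow> complex)
      (f :: nat \<Rightarrow> complex \<Rightarrow> complex).
        0 < n \<and> p 0 = z \<and> p n = w \<and>
        (\<forall>i<n. f i holomorphic_on ball 0 1 \<and> f i ` ball 0 1 \<subseteq> \<Omega> \<and>
               a i \<in> ball 0 1 \<and> b i \<in> ball 0 1 \<and>
               f i (a i) = p i \<and> f i (b i) = p (Suc i))}"

text \<open>The Kobayashi pseudodistance. The value 0 off \<open>\<Omega> \<times> \<Omega>\<close> is a dummy: the locale
  \<^locale>\<open>Metric_space\<close> asks for nonnegativity and symmetry at all arguments. On a domain
  the infimum is over a nonempty set of nonnegative reals.\<close>
definition kobayashi_dist :: "complex set \<Rightarrow> complex \<Rightarrow> complex \<Rightarrow> real" where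
  "kobayashi_dist \<Omega> z w = (if z \<in> \<Omega> \<and> w \<in> \<Omega> then Inf (chain_lengths \<Omega> z w) else 0)"

definition hyperbolic_domain :: "complex set \<Rightarrow> bool" where
  "hyperbolic_domain \<Omega> \<longleftrightarrow> planar_domain \<Omega> \<and> Metric_space \<Omega> (kobayashi_dist \<Omega>)"

definition condition_1 :: "complex set \<Rightarrow> bool" where
  "condition_1 \<Omega> \<longleftrightarrow> hyperbolic_domain \<Omega> \<and>
    (\<forall>p \<in> frontier \<Omega>. \<exists>r>0. \<exists>\<tau> :: complex \<Rightarrow> complex.
        embedding_map (top_of_set (cball 0 1)) (top_of_set (closure \<Omega>)) \<tau> \<and>
        \<tau> ` ball 0 1 \<subseteq> \<Omega> \<and>
        ball p r \<inter> \<Omega> \<subseteq> \<tau> ` ball 0 1)"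

text \<open>The supremum is taken in \<open>[0,1]\<close>, so that it is 0 when there is no admissible radius
  (as for the complement of two points); this is the role of \<open>insert 0\<close>.\<close>
definition squeezing :: "complex set \<Rightarrow> complex \<Rightarrow> real" where
  "squeezing \<Omega> z = Sup (insert 0
    {r. 0 < r \<and> r \<le> 1 \<and>
        (\<exists>\<phi>. \<phi> holomorphic_on \<Omega> \<and> inj_on \<phi> \<Omega> \<and> \<phi> ` \<Omega> \<subseteq> ball 0 1 \<and>
             \<phi> z = 0 \<and> ball 0 r \<subseteq> \<phi> ` \<Omega>)})"

end

theory Submission imports Defs begin

text \<open>
  Why the squeezing function tends to 1. By the embedded closed disc, the part of the boundary
  of \<open>\<Omega>\<close> close to \<open>p\<close> lies on an arc, the image of an arc of the unit circle. This arc and the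
  points of a small disc around \<open>p\<close> outside \<open>\<Omega>\<close> form one connected set \<open>K\<close> in the complement
  (\<open>connected_complement_piece_of_embedded_disc\<close>). Fill in all other holes: in the Riemann
  sphere the component \<open>V\<close> of the complement of the closure of \<open>K\<close> that contains \<open>\<Omega>\<close> is simply
  connected, and it coincides with \<open>\<Omega>\<close> near \<open>p\<close>. For \<open>z\<close> in \<open>\<Omega>\<close> compose a Riemann map of \<open>V\<close> with a disc
  automorphism so that \<open>z\<close> goes to 0. The restriction to \<open>\<Omega>\<close> is an injective map into the unit
  disc that omits only the image of \<open>V - \<Omega>\<close>, and \<open>V - \<Omega>\<close> stays away from \<open>p\<close>.

  It remains to see that for \<open>z\<close> close to \<open>p\<close> this omitted part is near the unit circle. The
  inverse map \<open>F\<close> from the disc to \<open>V\<close> is univalent and omits \<open>p\<close>. A weak form of the Koebe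
  distortion theorem (\<open>univalent_distortion_omitted_value\<close>) bounds \<open>F c - p\<close> by a constant
  multiple of \<open>F 0 - p = z - p\<close>, uniformly for \<open>c\<close> in a smaller disc of radius \<open>t < 1\<close>. So \<open>F\<close>
  maps that disc close to \<open>p\<close>, hence into \<open>\<Omega>\<close>, and the squeezing function at \<open>z\<close> is at least
  \<open>t\<close>.

  Only the plane is used, not the sphere: an end point \<open>q\<close> of the arc, left out of \<open>K\<close>, is sent
  to infinity by \<open>w \<mapsto> 1 / (w - q)\<close>. Then \<open>K\<close> becomes unbounded, and the components of the
  complement of an unbounded connected closed set are simply connected.
\<close>

section \<open>Distortion of univalent functions with an omitted value\<close>

text \<open>
  A logarithm \<open>H\<close> of \<open>F - p\<close> cannot take two values that differ by \<open>2 * pi * \<i>\<close>, because \<open>F\<close>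
  would be equal at the two points. So the image of \<open>H\<close> contains no disc of radius 4, which
  exceeds \<open>pi\<close>. By Bloch's theorem, with its constant \<open>1/12\<close>, this bounds the derivative of \<open>H\<close>
  on the disc of radius \<open>t\<close> by \<open>48 / (1 - t)\<close>, and hence the variation of
  \<open>Re H = ln (cmod (F - p))\<close>.
\<close>

lemma univalent_distortion_omitted_value:
  assumes holF: "F holomorphic_on ball 0 1" and injF: "inj_on F (ball 0 1)"
    and p: "p \<notin> F ` ball 0 1" and t: "t < 1" and c: "cmod c \<le> t"
  shows "cmod (F c - p) \<le> exp (48 / (1 - t)) * cmod (F 0 - p)"
proof -
  have "(\<lambda>w. F w - p) holomorphic_on ball 0 1"
    by (intro holomorphic_intros holF)
  moreover have "F w - p \<noteq> 0" if "w \<in> ball 0 1" for w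
    using p that by auto
  ultimately obtain H where holH: "H holomorphic_on ball 0 1"
      and H: "\<And>w. w \<in> ball 0 1 \<Longrightarrow> F w - p = exp (H w)"
    using contractible_imp_holomorphic_log[of "\<lambda>w. F w - p" "ball 0 1"]
      convex_imp_contractible[OF convex_ball] by metis
  have no_ball: "\<not> ball b 4 \<subseteq> H ` ball 0 1" for b
  proof
    assume sub: "ball b 4 \<subseteq> H ` ball 0 1"
    have pi4: "cmod (pi * \<i>) < 4"
      using pi_less_4 by (simp add: norm_mult)
    then have "b - pi * \<i> \<in> ball b 4" "b + pi * \<i> \<in> ball b 4"
      by (simp_all add: dist_norm)
    then have "b - pi * \<i> \<in> H ` ball 0 1" "b + pi * \<i> \<in> H ` ball 0 1"
      using sub by auto
    then obtain u v where u: "u \<in> ball 0 1" "H u = b - pi * \<i>"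
        and v: "v \<in> ball 0 1" "H v = b + pi * \<i>"
      by (elim imageE) auto
    have "exp (H u) = exp (H v)"
      unfolding u(2) v(2) exp_add exp_diff by simp
    then have "F u = F v"
      using H[OF u(1)] H[OF v(1)] by (metis diff_add_cancel)
    then have "u = v"
      using injF u(1) v(1) by (auto dest: inj_onD)
    then show False
      using u(2) v(2) by simp
  qed
  have deriv_le: "cmod (deriv H a) \<le> 48 / (1 - t)" if a: "a \<in> cball 0 t" for a
  proof (rule ccontr)
    assume "\<not> ?thesis"
    then have "48 < cmod (deriv H a) * (1 - t)"
      using t by (simp add: field_simps)
    also have "\<dots> \<le> cmod (deriv H a) * (1 - cmod a)"
      using a by (intro mult_left_mono) auto
    finally have big: "4 \<le> (1 - cmod a) * cmod (deriv H a) / 12"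
      by (simp add: mult.commute)
    have sub: "ball a (1 - cmod a) \<subseteq> ball 0 1"
      by (simp add: ball_subset_ball_iff)
    have "0 < 1 - cmod a"
      using a t by simp
    from Bloch[OF holomorphic_on_subset[OF holH sub] this big]
    obtain b where "ball b 4 \<subseteq> H ` ball a (1 - cmod a)"
      by metis
    then show False
      using no_ball[of b] sub by blast
  qed
  have t0: "0 \<le> t"
    using c norm_ge_zero order_trans by blast
  have "cmod (H c - H 0) \<le> 48 / (1 - t) * cmod (c - 0)"
  proof (rule field_differentiable_bound[where S = "cball 0 t"])
    show "(H has_field_derivative deriv H a) (at a within cball 0 t)" if "a \<in> cball 0 t" for a
      using holomorphic_derivI[OF holH open_ball, of a] that t
      by (auto intro: has_field_derivative_at_within)
  qed (use deriv_le c t0 in auto)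
  also have "\<dots> \<le> 48 / (1 - t)"
    using c t by (intro mult_left_le) auto
  finally have "Re (H c) \<le> 48 / (1 - t) + Re (H 0)"
    using complex_Re_le_cmod[of "H c - H 0"] by simp
  then have "exp (Re (H c)) \<le> exp (48 / (1 - t)) * exp (Re (H 0))"
    by (simp flip: exp_add)
  moreover have "cmod (F c - p) = exp (Re (H c))" "cmod (F 0 - p) = exp (Re (H 0))"
    using H[of c] H[of 0] c t by auto
  ultimately show ?thesis
    by simp
qed

section \<open>Elementary properties of the squeezing function\<close>

lemma squeezing_set_bdd_above:
  "bdd_above (insert 0 {r. 0 < r \<and> r \<le> 1 \<and>
        (\<exists>\<phi>. \<phi> holomorphic_on \<Omega> \<and> inj_on \<phi> \<Omega> \<and> \<phi> ` \<Omega> \<subseteq> ball 0 1 \<and>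
             \<phi> z = 0 \<and> ball 0 r \<subseteq> \<phi> ` \<Omega>)} :: real set)"
  by (rule bdd_aboveI[of _ 1]) auto

lemma squeezing_le_1: "squeezing \<Omega> z \<le> 1"
  unfolding squeezing_def by (rule cSup_least) auto

lemma squeezing_geI:
  assumes "0 < r" "r \<le> 1" "\<phi> holomorphic_on \<Omega>" "inj_on \<phi> \<Omega>" "\<phi> ` \<Omega> \<subseteq> ball 0 1"
    "\<phi> z = 0" "ball 0 r \<subseteq> \<phi> ` \<Omega>"
  shows "r \<le> squeezing \<Omega> z"
  unfolding squeezing_def
  by (rule cSup_upper[OF _ squeezing_set_bdd_above]) (use assms in blast)

text \<open>
  The competitors on the image pull back along \<open>T\<close>. This transfers the lower bound obtained after
  a change of coordinate to the given domain.
\<close>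

lemma squeezing_image_le:
  assumes holT: "T holomorphic_on \<Omega>" and injT: "inj_on T \<Omega>"
  shows "squeezing (T ` \<Omega>) (T z) \<le> squeezing \<Omega> z"
  unfolding squeezing_def[of "T ` \<Omega>"]
proof (rule cSup_least)
  fix r :: real
  assume r: "r \<in> insert 0 {r. 0 < r \<and> r \<le> 1 \<and>
        (\<exists>\<phi>. \<phi> holomorphic_on T ` \<Omega> \<and> inj_on \<phi> (T ` \<Omega>) \<and> \<phi> ` T ` \<Omega> \<subseteq> ball 0 1 \<and>
             \<phi> (T z) = 0 \<and> ball 0 r \<subseteq> \<phi> ` T ` \<Omega>)}"
  show "r \<le> squeezing \<Omega> z"
  proof (cases "r = 0")
    case True
    then show ?thesis
      unfolding squeezing_def by (auto intro: cSup_upper[OF _ squeezing_set_bdd_above])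
  next
    case False
    with r obtain \<phi> where "0 < r" "r \<le> 1" and \<phi>: "\<phi> holomorphic_on T ` \<Omega>"
        "inj_on \<phi> (T ` \<Omega>)" "\<phi> ` T ` \<Omega> \<subseteq> ball 0 1" "\<phi> (T z) = 0" "ball 0 r \<subseteq> \<phi> ` T ` \<Omega>"
      by auto
    show ?thesis
    proof (rule squeezing_geI)
      show "(\<phi> \<circ> T) holomorphic_on \<Omega>"
        by (rule holomorphic_on_compose[OF holT \<phi>(1)])
      show "inj_on (\<phi> \<circ> T) \<Omega>"
        by (rule comp_inj_on[OF injT \<phi>(2)])
    qed (use \<phi> \<open>0 < r\<close> \<open>r \<le> 1\<close> in \<open>auto simp: image_comp\<close>)
  qed
qed auto

lemma tendsto_1_squeezingI:
  assumes "\<And>t. 0 < t \<Longrightarrow> t < 1 \<Longrightarrow> \<forall>\<^sub>F z in A. t \<le> squeezing \<Omega> z"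
  shows "(squeezing \<Omega> \<longlongrightarrow> 1) A"
proof (rule order_tendstoI)
  fix a :: real
  assume "a < 1"
  define t where "t = (max a 0 + 1) / 2"
  have t: "0 < t" "t < 1" "a < t"
    using \<open>a < 1\<close> by (auto simp: t_def)
  show "\<forall>\<^sub>F z in A. a < squeezing \<Omega> z"
    using assms[OF t(1,2)] by eventually_elim (use t in simp)
next
  fix a :: real
  assume "1 < a"
  then have "squeezing \<Omega> z < a" for z
    using squeezing_le_1[of \<Omega> z] by linarith
  then show "\<forall>\<^sub>F z in A. squeezing \<Omega> z < a"
    by simp
qed

section \<open>Filling the holes of a domain\<close>

text \<open>
  The complement of \<open>V\<close> consists of \<open>L\<close> and the other components of the complement of \<open>L\<close>, all of
  which adhere to \<open>L\<close>. It is therefore a single unbounded connected set, so \<open>V\<close> has no holes.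
\<close>

lemma simply_connected_component_complement:
  fixes L :: "complex set"
  assumes "closed L" "connected L" "\<not> bounded L" "V \<in> components (- L)"
  shows "simply_connected V"
proof -
  have V: "open V" "connected V" "L \<subseteq> - V"
    using assms open_components[of "- L" V] in_components_connected[of V "- L"]
      in_components_subset[of V "- L"] by (auto simp: open_Compl)
  have "connected (- V)"
    by (rule component_complement_connected[OF assms(2,4)])
  moreover have "\<not> bounded (- V)"
    using V(3) assms(3) bounded_subset by blast
  ultimately have "\<forall>C \<in> components (- V). \<not> bounded C"
    by (metis components_eq_sing_iff components_empty empty_iff singletonD)
  then show ?thesis
    using V by (simp add: simply_connected_eq_unbounded_complement_components)
qed

text \<open>
  The main step. The set \<open>L\<close> contains every point outside \<open>\<Omega>\<close> that is close to \<open>p\<close>, so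
  the simply connected domain obtained by removing only the closure of \<open>L\<close> agrees with \<open>\<Omega>\<close> near
  \<open>p\<close>, and its Riemann map can serve as a competitor for the squeezing function of \<open>\<Omega>\<close>.
\<close>

lemma squeezing_tendsto_1_of_unbounded_connected_complement:
  fixes \<Omega> L :: "complex set"
  assumes \<Omega>: "open \<Omega>" "connected \<Omega>"
    and L: "connected L" "\<not> bounded L" "L \<inter> \<Omega> = {}"
    and \<rho>: "0 < \<rho>" "ball p \<rho> - \<Omega> \<subseteq> L" and p: "p \<notin> \<Omega>"
  shows "(squeezing \<Omega> \<longlongrightarrow> 1) (at p within \<Omega>)"
proof (cases "\<Omega> = {}")
  case True
  then show ?thesis by simp
next
  case False
  have cl: "\<Omega> \<subseteq> - closure L"
    using L(3) \<Omega>(1) open_Int_closure_eq_empty by blast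
  then obtain V where V: "V \<in> components (- closure L)" and \<Omega>V: "\<Omega> \<subseteq> V"
    using exists_component_superset[OF cl _ \<Omega>(2)] False by blast
  have VL: "V \<inter> L = {}"
    using in_components_subset[OF V] closure_subset by fastforce
  have "p \<in> L"
    using \<rho> p by auto
  then have "p \<notin> V"
    using VL by blast
  have "simply_connected V"
    using V L(1,2) bounded_subset[OF _ closure_subset, of L]
    by (intro simply_connected_component_complement[of "closure L"])
       (auto intro: connected_imp_connected_closure)
  moreover have "open V"
    using V by (metis open_components closed_closure open_Compl)
  moreover have "V \<noteq> {}" "V \<noteq> UNIV"
    using \<Omega>V False \<open>p \<notin> V\<close> by auto
  ultimately obtain f g where f: "f holomorphic_on V" and g: "g holomorphic_on ball 0 1"
      and fg: "\<And>z. z \<in> V \<Longrightarrow> f z \<in> ball 0 1 \<and> g (f z) = z"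
      and gf: "\<And>z. z \<in> ball 0 1 \<Longrightarrow> g z \<in> V \<and> f (g z) = z"
    using Riemann_mapping_theorem[of V] by blast
  have key: "t \<le> squeezing \<Omega> z"
    if t: "0 < t" "t < 1" and z: "z \<in> \<Omega>" "exp (48 / (1 - t)) * cmod (z - p) < \<rho>" for t z
  proof -
    have zV: "z \<in> V"
      using z \<Omega>V by blast
    then have "f z \<in> ball 0 1"
      using fg by blast
    then obtain m n where m0: "m (f z) = 0" and m: "m holomorphic_on ball 0 1" "m ` ball 0 1 \<subseteq> ball 0 1"
      and n: "n holomorphic_on ball 0 1" "n ` ball 0 1 \<subseteq> ball 0 1"
      and mn: "\<And>z. z \<in> ball 0 1 \<Longrightarrow> m (n z) = z" and nm: "\<And>z. z \<in> ball 0 1 \<Longrightarrow> n (m z) = z"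
      using ball_biholomorphism_exists by metis
    \<comment> \<open>\<open>F\<close> parametrises \<open>V\<close> with centre \<open>z\<close>; its inverse \<open>m \<circ> f\<close> is the competitor.\<close>
    define F where "F = g \<circ> n"
    have n0: "n 0 = f z"
      using nm[OF \<open>f z \<in> ball 0 1\<close>] m0 by simp
    have F0: "F 0 = z"
      using fg[OF zV] n0 by (simp add: F_def)
    have nin: "n c \<in> ball 0 1" if "c \<in> ball 0 1" for c
      using n(2) that by blast
    have FV: "F c \<in> V" "m (f (F c)) = c" if "c \<in> ball 0 1" for c
      using gf[OF nin[OF that]] mn[OF that] by (auto simp: F_def)
    have holF: "F holomorphic_on ball 0 1"
      unfolding F_def using n g by (intro holomorphic_on_compose_gen[of n _ g "ball 0 1"]) auto
    have injF: "inj_on F (ball 0 1)"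
      by (rule inj_on_inverseI[of _ "m \<circ> f"]) (simp add: FV)
    have Fp: "p \<notin> F ` ball 0 1"
      using FV \<open>p \<notin> V\<close> by blast
    show ?thesis
    proof (rule squeezing_geI)
      show "(m \<circ> f) holomorphic_on \<Omega>"
        using fg \<Omega>V m(1) holomorphic_on_subset[OF f \<Omega>V]
        by (intro holomorphic_on_compose_gen[of f _ m "ball 0 1"]) auto
      show "inj_on (m \<circ> f) \<Omega>"
      proof (rule inj_on_inverseI[of _ "g \<circ> n"])
        fix x assume "x \<in> \<Omega>"
        then show "(g \<circ> n) ((m \<circ> f) x) = x"
          using fg[of x] \<Omega>V nm[of "f x"] by auto
      qed
      show "(m \<circ> f) ` \<Omega> \<subseteq> ball 0 1"
        using fg \<Omega>V m(2) by (auto simp: image_subset_iff subset_iff)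
      show "ball 0 t \<subseteq> (m \<circ> f) ` \<Omega>"
      proof
        fix c :: complex
        assume c: "c \<in> ball 0 t"
        then have c1: "c \<in> ball 0 1" and ct: "cmod c \<le> t"
          using t by auto
        have "cmod (F c - p) < \<rho>"
          using univalent_distortion_omitted_value[OF holF injF Fp t(2) ct] z(2) F0 by simp
        then have "F c \<in> ball p \<rho>"
          by (simp add: dist_norm norm_minus_commute)
        then have "F c \<in> \<Omega>"
          using FV(1)[OF c1] VL \<rho>(2) by blast
        then show "c \<in> (m \<circ> f) ` \<Omega>"
          using FV(2)[OF c1] by (metis comp_apply imageI)
      qed
    qed (use t m0 in auto)
  qed
  show ?thesis
  proof (rule tendsto_1_squeezingI)
    fix t :: real
    assume t: "0 < t" "t < 1"
    have "((\<lambda>z. exp (48 / (1 - t)) * cmod (z - p)) \<longlongrightarrow> exp (48 / (1 - t)) * cmod (p - p)) (at p within \<Omega>)"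
      by (intro tendsto_intros)
    then have "\<forall>\<^sub>F z in at p within \<Omega>. exp (48 / (1 - t)) * cmod (z - p) < \<rho>"
      using \<rho>(1) by (intro order_tendstoD(2)) auto
    moreover have "\<forall>\<^sub>F z in at p within \<Omega>. z \<in> \<Omega>"
      by (simp add: eventually_at_filter)
    ultimately show "\<forall>\<^sub>F z in at p within \<Omega>. t \<le> squeezing \<Omega> z"
      by eventually_elim (use key t in blast)
  qed
qed

section \<open>The complement near a boundary point covered by an embedded disc\<close>

text \<open>
  Within \<open>ball p r\<close> the boundary of \<open>\<Omega>\<close> and the curve \<open>\<tau> ` sphere 0 1\<close> are the same:
  a boundary point is a limit of points of the image of the disc, hence lies in the compact set
  \<open>\<tau> ` cball 0 1\<close>, and the curve avoids \<open>\<Omega>\<close> because \<open>\<tau>\<close> is injective. As the inverse of \<open>\<tau>\<close> is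
  continuous, the boundary points close enough to \<open>p\<close> even lie on a short arc through \<open>p\<close>. Every
  point outside \<open>\<Omega>\<close> near \<open>p\<close> is joined to this arc by a segment towards \<open>\<Omega>\<close>, cut off
  where it first meets the boundary. Hence the arc together with these points is connected.
  One end point \<open>q\<close> is left out of the arc, to be used as the pole of a coordinate change that
  makes \<open>K\<close> unbounded; removing an end point keeps the arc connected.
\<close>

lemma connected_complement_piece_of_embedded_disc:
  fixes \<tau> :: "complex \<Rightarrow> complex"
  assumes \<Omega>: "open \<Omega>" and p: "p \<in> frontier \<Omega>" and r: "0 < r"
    and cont: "continuous_on (cball 0 1) \<tau>" and inj: "inj_on \<tau> (cball 0 1)"
    and inside: "\<tau> ` ball 0 1 \<subseteq> \<Omega>" and cover: "ball p r \<inter> \<Omega> \<subseteq> \<tau> ` ball 0 1"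
  obtains K q \<rho> where "connected K" "K \<inter> \<Omega> = {}" "0 < \<rho>" "ball p \<rho> - \<Omega> \<subseteq> K"
    "q \<notin> \<Omega>" "q \<notin> K" "q \<in> closure K"
proof -
  obtain \<sigma> where \<sigma>: "homeomorphism (cball 0 1) (\<tau> ` cball 0 1) \<tau> \<sigma>"
    using homeomorphism_compact[OF compact_cball cont refl inj] by blast
  have \<sigma>\<tau>: "\<sigma> (\<tau> \<zeta>) = \<zeta>" if "cmod \<zeta> \<le> 1" for \<zeta>
    using \<sigma> that by (simp add: homeomorphism_apply1)
  have boundary_on_curve: "\<exists>\<zeta>. cmod \<zeta> = 1 \<and> x = \<tau> \<zeta>"
    if x: "x \<in> closure \<Omega>" "x \<in> ball p r" "x \<notin> \<Omega>" for x
  proof -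
    have "x \<in> closure (ball p r \<inter> \<Omega>)"
      using open_Int_closure_subset[OF open_ball] x by blast
    also have "\<dots> \<subseteq> \<tau> ` cball 0 1"
    proof (rule closure_minimal)
      show "ball p r \<inter> \<Omega> \<subseteq> \<tau> ` cball 0 1"
        using cover ball_subset_cball by blast
      show "closed (\<tau> ` cball 0 1)"
        by (intro compact_imp_closed compact_continuous_image cont compact_cball)
    qed
    finally obtain \<zeta> where \<zeta>: "\<zeta> \<in> cball 0 1" "x = \<tau> \<zeta>"
      by blast
    then have "\<zeta> \<notin> ball 0 1"
      using x(3) inside by blast
    then show ?thesis
      using \<zeta> by auto
  qed
  have curve_avoids: "\<tau> \<zeta> \<notin> \<Omega>" if \<zeta>: "cmod \<zeta> = 1" "\<tau> \<zeta> \<in> ball p r" for \<zeta>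
  proof
    assume "\<tau> \<zeta> \<in> \<Omega>"
    then obtain \<xi> where \<xi>: "\<xi> \<in> ball 0 1" "\<tau> \<zeta> = \<tau> \<xi>"
      using cover \<zeta>(2) by blast
    then have "\<zeta> = \<xi>"
      using inj \<zeta>(1) by (auto dest: inj_onD)
    then show False
      using \<xi>(1) \<zeta>(1) by simp
  qed
  have \<tau>_closure: "\<tau> \<zeta> \<in> closure \<Omega>" if "cmod \<zeta> \<le> 1" for \<zeta>
  proof -
    have "\<tau> ` closure (ball 0 1) \<subseteq> closure \<Omega>"
      using cont inside closure_subset by (intro image_closure_subset) auto
    then show ?thesis
      using that by auto
  qed
  have pcl: "p \<in> closure \<Omega>" and p\<Omega>: "p \<notin> \<Omega>"
    using p \<Omega> by (auto simp: frontier_def interior_open)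
  then obtain \<zeta>0 where \<zeta>0: "cmod \<zeta>0 = 1" "p = \<tau> \<zeta>0"
    using boundary_on_curve[of p] r by auto
  have \<zeta>0_nz: "\<zeta>0 \<noteq> 0"
    using \<zeta>0(1) by auto
  define \<gamma> where "\<gamma> s = \<tau> (\<zeta>0 * cis s)" for s
  have \<gamma>0: "\<gamma> 0 = p"
    by (simp add: \<gamma>_def \<zeta>0)
  have cont_\<gamma>: "continuous_on UNIV \<gamma>"
    unfolding \<gamma>_def
    by (rule continuous_on_compose2[OF cont]) (auto intro!: continuous_intros simp: norm_mult \<zeta>0)
  then obtain d where d: "0 < d" "\<And>s. \<bar>s\<bar> < d \<Longrightarrow> \<gamma> s \<in> ball p r"
    using r \<gamma>0 unfolding continuous_on_iff
    by (metis UNIV_I dist_commute dist_real_def diff_zero mem_ball)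
  \<comment> \<open>The bound \<open>d / 2\<close> keeps the closed arc inside \<open>ball p r\<close>. The bound 1 is below \<open>pi\<close>, so that
     \<open>cis\<close> is injective on the parameter interval and \<open>q\<close> is not on the half-open arc.\<close>
  define \<epsilon> where "\<epsilon> = min (d / 2) 1"
  have \<epsilon>: "0 < \<epsilon>" "\<epsilon> < d" "\<epsilon> < pi"
    using d(1) pi_gt3 by (auto simp: \<epsilon>_def)
  have \<gamma>_ball: "\<gamma> s \<in> ball p r" if "\<bar>s\<bar> \<le> \<epsilon>" for s
    using d(2)[of s] that \<epsilon> by simp
  have \<gamma>_avoids: "\<gamma> s \<notin> \<Omega>" if "\<bar>s\<bar> \<le> \<epsilon>" for s
    using curve_avoids[of "\<zeta>0 * cis s"] \<gamma>_ball[OF that] by (simp add: \<gamma>_def norm_mult \<zeta>0)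
  have "isCont Arg 1"
    by (rule continuous_at_Arg) auto
  then obtain \<eta> where \<eta>: "0 < \<eta>" "\<And>\<xi>. dist \<xi> 1 < \<eta> \<Longrightarrow> \<bar>Arg \<xi>\<bar> < \<epsilon>"
    using \<epsilon>(1) unfolding continuous_at_eps_delta by (metis Arg_1 dist_real_def diff_zero)
  have "continuous_on (\<tau> ` cball 0 1) \<sigma>"
    using \<sigma> by (rule homeomorphism_cont2)
  moreover have "p \<in> \<tau> ` cball 0 1"
    using \<zeta>0 by auto
  ultimately obtain \<rho>0 where \<rho>0: "0 < \<rho>0"
      "\<And>x. \<lbrakk>x \<in> \<tau> ` cball 0 1; dist x p < \<rho>0\<rbrakk> \<Longrightarrow> dist (\<sigma> x) (\<sigma> p) < \<eta>"
    using \<eta>(1) unfolding continuous_on_iff by metis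
  define \<rho> where "\<rho> = min r \<rho>0"
  have \<rho>: "0 < \<rho>" "\<rho> \<le> r" "\<rho> \<le> \<rho>0"
    using r \<rho>0(1) by (auto simp: \<rho>_def)
  define A where "A = \<gamma> ` {-\<epsilon><..\<epsilon>}"
  have boundary_on_arc: "x \<in> A"
    if x: "x \<in> closure \<Omega>" "x \<in> ball p \<rho>" "x \<notin> \<Omega>" for x
  proof -
    obtain \<zeta> where \<zeta>: "cmod \<zeta> = 1" "x = \<tau> \<zeta>"
      using boundary_on_curve[of x] x \<rho>(2) by auto
    have "dist (\<sigma> x) (\<sigma> p) < \<eta>"
      using x(2) \<rho>(3) \<zeta> by (intro \<rho>0(2)) (auto simp: dist_commute)
    then have "dist \<zeta> \<zeta>0 < \<eta>"
      using \<sigma>\<tau>[of \<zeta>] \<sigma>\<tau>[of \<zeta>0] \<zeta> \<zeta>0 by simp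
    moreover have "\<zeta> / \<zeta>0 - 1 = (\<zeta> - \<zeta>0) / \<zeta>0"
      using \<zeta>0_nz by (simp add: diff_divide_distrib)
    ultimately have "dist (\<zeta> / \<zeta>0) 1 < \<eta>"
      using \<zeta>0(1) by (simp add: dist_norm norm_divide)
    then have "\<bar>Arg (\<zeta> / \<zeta>0)\<bar> < \<epsilon>"
      by (rule \<eta>(2))
    moreover have "cis (Arg (\<zeta> / \<zeta>0)) = \<zeta> / \<zeta>0"
      using \<zeta>(1) \<zeta>0(1) by (subst cis_Arg) (auto simp: sgn_div_norm norm_divide)
    then have "\<gamma> (Arg (\<zeta> / \<zeta>0)) = x"
      using \<zeta>0_nz \<zeta>(2) by (simp add: \<gamma>_def)
    ultimately show ?thesis
      unfolding A_def by (intro image_eqI[of _ _ "Arg (\<zeta> / \<zeta>0)"]) auto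
  qed
  define K where "K = A \<union> (ball p \<rho> - \<Omega>)"
  define q where "q = \<gamma> (-\<epsilon>)"
  have "connected A"
    unfolding A_def
    by (intro connected_continuous_image continuous_on_subset[OF cont_\<gamma>]) auto
  have pA: "p \<in> A"
    using \<gamma>0 \<epsilon>(1) unfolding A_def by force
  have to_p: "connected_component K x p" if "x \<in> K" for x
  proof (cases "x \<in> A")
    case True
    then show ?thesis
      unfolding connected_component_def using \<open>connected A\<close> pA K_def by blast
  next
    case False
    then have x: "x \<in> ball p \<rho>" "x \<notin> \<Omega>"
      using that by (auto simp: K_def)
    have "ball p \<rho> \<inter> \<Omega> \<noteq> {}"
      using pcl \<rho>(1) open_Int_closure_eq_empty[OF open_ball, of p \<rho> \<Omega>] by force
    then obtain y where y: "y \<in> ball p \<rho>" "y \<in> \<Omega>"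
      by blast
    obtain h where h: "path h" "pathstart h = x" "path_image h \<subseteq> closed_segment x y \<inter> - \<Omega>"
        "pathfinish h \<in> frontier (- \<Omega>)"
      using exists_path_subpath_to_frontier_closed[of "- \<Omega>" "linepath x y"] x(2) y(2) \<Omega>
      by auto
    have seg: "closed_segment x y \<subseteq> ball p \<rho>"
      using x(1) y(1) by (rule closed_segment_subset) simp
    have fin: "pathfinish h \<in> path_image h"
      by (rule pathfinish_in_path_image)
    have "pathfinish h \<in> closure \<Omega>"
      using h(4) by (simp add: frontier_closures)
    then have "pathfinish h \<in> A"
      using boundary_on_arc[of "pathfinish h"] fin h(3) seg by blast
    moreover have "path_image h \<subseteq> K"
      using h(3) seg by (auto simp: K_def)
    moreover have "x \<in> path_image h"
      using h(2) pathstart_in_path_image by blast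
    ultimately have "connected_component K x (pathfinish h)" "connected_component K (pathfinish h) p"
      unfolding connected_component_def
      using connected_path_image[OF h(1)] fin \<open>connected A\<close> pA K_def by blast+
    then show ?thesis
      by (rule connected_component_trans)
  qed
  show thesis
  proof (rule that[of K \<rho> q])
    show "connected K"
      using to_p by (meson connected_component_sym connected_component_trans connected_iff_connected_component)
    show "K \<inter> \<Omega> = {}"
      using \<gamma>_avoids by (auto simp: K_def A_def)
    show "0 < \<rho>" "ball p \<rho> - \<Omega> \<subseteq> K"
      using \<rho> by (auto simp: K_def)
    show q\<Omega>: "q \<notin> \<Omega>"
      using \<gamma>_avoids[of "-\<epsilon>"] \<epsilon> by (simp add: q_def)
    have qA: "q \<notin> A"
    proof
      assume "q \<in> A"
      then obtain s where s: "s \<in> {-\<epsilon><..\<epsilon>}" "\<gamma> (-\<epsilon>) = \<gamma> s"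
        by (auto simp: q_def A_def)
      have "\<zeta>0 * cis (-\<epsilon>) = \<zeta>0 * cis s"
        using inj_onD[OF inj s(2)[unfolded \<gamma>_def]] \<zeta>0(1) by (simp add: norm_mult)
      then have "cis (-\<epsilon>) = cis s"
        using \<zeta>0_nz by simp
      then have "-\<epsilon> = s"
        using Arg_cis[of "-\<epsilon>"] Arg_cis[of s] s(1) \<epsilon> by auto
      then show False
        using s(1) by simp
    qed
    show "q \<in> closure K"
    proof -
      have "\<gamma> ` closure {-\<epsilon><..\<epsilon>} \<subseteq> closure K"
      proof (rule image_closure_subset)
        show "continuous_on (closure {-\<epsilon><..\<epsilon>}) \<gamma>"
          using cont_\<gamma> by (rule continuous_on_subset) simp
        show "\<gamma> ` {-\<epsilon><..\<epsilon>} \<subseteq> closure K"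
          using closure_subset[of K] by (auto simp: K_def A_def)
      qed simp
      then show ?thesis
        using \<epsilon>(1) by (auto simp: q_def)
    qed
    have "q \<in> closure \<Omega>"
      using \<tau>_closure \<zeta>0(1) by (auto simp: q_def \<gamma>_def norm_mult)
    then have "q \<notin> ball p \<rho>"
      using boundary_on_arc[of q] q\<Omega> qA by blast
    then show "q \<notin> K"
      using qA by (simp add: K_def)
  qed
qed

section \<open>Moving an end point to infinity\<close>

text \<open>
  The map \<open>w \<mapsto> 1 / (w - q)\<close> is injective and holomorphic on \<open>\<Omega>\<close>, and it sends \<open>K\<close> to an unbounded
  set because \<open>K\<close> accumulates at \<open>q\<close>.
\<close>

lemma squeezing_tendsto_1_of_punctured_connected_complement:
  fixes \<Omega> K :: "complex set"
  assumes \<Omega>: "open \<Omega>" "connected \<Omega>"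
    and K: "connected K" "K \<inter> \<Omega> = {}" and \<rho>: "0 < \<rho>" "ball p \<rho> - \<Omega> \<subseteq> K"
    and q: "q \<notin> \<Omega>" "q \<notin> K" "q \<in> closure K" and p: "p \<notin> \<Omega>"
  shows "(squeezing \<Omega> \<longlongrightarrow> 1) (at p within \<Omega>)"
proof -
  define T where "T w = inverse (w - q)" for w
  have injT: "inj T"
    by (auto simp: T_def inj_on_def)
  have holT: "T holomorphic_on \<Omega>"
    unfolding T_def using q(1) by (intro holomorphic_intros) auto
  have "p \<in> K"
    using \<rho> p by auto
  then have pq: "p \<noteq> q"
    using q(2) by blast
  have lim: "(squeezing (T ` \<Omega>) \<longlongrightarrow> 1) (at (T p) within T ` \<Omega>)"
  proof -
    \<comment> \<open>The inverse of \<open>T\<close> is \<open>w \<mapsto> q + inverse w\<close>, also at \<open>w = 0 = T q\<close>, as \<open>inverse 0 = 0\<close>.\<close>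
    have "isCont (\<lambda>w. q + inverse w) (T p)"
      using pq by (intro continuous_intros) (auto simp: T_def)
    moreover have "q + inverse (T p) = p"
      by (simp add: T_def)
    ultimately obtain \<delta> where \<delta>: "0 < \<delta>" "\<And>w. dist w (T p) < \<delta> \<Longrightarrow> dist (q + inverse w) p < \<rho>"
      using \<rho>(1) unfolding continuous_at_eps_delta by metis
    show ?thesis
    proof (rule squeezing_tendsto_1_of_unbounded_connected_complement[where L = "T ` K"])
      show "open (T ` \<Omega>)"
        using injT by (intro open_mapping_thm3 holT \<Omega>(1)) (auto intro: inj_on_subset)
      show "connected (T ` \<Omega>)"
        using \<Omega>(2) holT by (intro connected_continuous_image holomorphic_on_imp_continuous_on)
      have "continuous_on K T"
        unfolding T_def using q(2) by (intro continuous_intros) auto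
      then show "connected (T ` K)"
        using K(1) by (rule connected_continuous_image)
      show "\<not> bounded (T ` K)"
      proof
        assume "bounded (T ` K)"
        then obtain B where B: "0 < B" "\<And>w. w \<in> K \<Longrightarrow> cmod (T w) \<le> B"
          unfolding bounded_pos by auto
        obtain w where w: "w \<in> K" "dist w q < inverse B"
          using q(3) B(1) unfolding closure_approachable by (metis inverse_positive_iff_positive)
        have "0 < cmod (w - q)"
          using w(1) q(2) by auto
        moreover have "cmod (w - q) < inverse B"
          using w(2) by (simp add: dist_norm)
        ultimately have "B < inverse (cmod (w - q))"
          using less_imp_inverse_less by fastforce
        then show False
          using B(2)[OF w(1)] by (simp add: T_def norm_inverse)
      qed
      show "T ` K \<inter> T ` \<Omega> = {}"
        using K(2) injT by (simp flip: image_Int)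
      show "ball (T p) \<delta> - T ` \<Omega> \<subseteq> T ` K"
      proof
        fix w assume w: "w \<in> ball (T p) \<delta> - T ` \<Omega>"
        have Tw: "T (q + inverse w) = w"
          by (simp add: T_def)
        have "q + inverse w \<in> ball p \<rho>"
          using \<delta>(2)[of w] w by (simp add: dist_commute)
        moreover have "q + inverse w \<notin> \<Omega>"
          using w Tw by (metis DiffD2 imageI)
        ultimately show "w \<in> T ` K"
          using \<rho>(2) Tw by (metis DiffI image_eqI subsetD)
      qed
      show "T p \<notin> T ` \<Omega>"
        using p injT by (simp add: inj_image_mem_iff)
    qed (fact \<delta>(1))
  qed
  have "filterlim T (at (T p) within T ` \<Omega>) (at p within \<Omega>)"
  proof (subst filterlim_at, intro conjI)
    show "(T \<longlongrightarrow> T p) (at p within \<Omega>)"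
      unfolding T_def using pq by (intro tendsto_intros) auto
    show "\<forall>\<^sub>F w in at p within \<Omega>. T w \<in> T ` \<Omega> \<and> T w \<noteq> T p"
      using injT by (auto simp: eventually_at_filter inj_eq)
  qed
  with lim have "((\<lambda>z. squeezing (T ` \<Omega>) (T z)) \<longlongrightarrow> 1) (at p within \<Omega>)"
    by (rule filterlim_compose)
  then show ?thesis
  proof (rule tendsto_sandwich[rotated 2])
    show "\<forall>\<^sub>F z in at p within \<Omega>. squeezing (T ` \<Omega>) (T z) \<le> squeezing \<Omega> z"
      using squeezing_image_le[OF holT inj_on_subset[OF injT subset_UNIV]] by simp
    show "\<forall>\<^sub>F z in at p within \<Omega>. squeezing \<Omega> z \<le> 1"
      by (simp add: squeezing_le_1)
  qed simp
qed

theorem proposition1p7: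
  fixes \<Omega> :: "complex set"
  assumes "planar_domain \<Omega>"
    and "condition_1 \<Omega>"
  shows "\<forall>p \<in> frontier \<Omega>. (squeezing \<Omega> \<longlongrightarrow> 1) (at p within \<Omega>)"
proof
  fix p assume p: "p \<in> frontier \<Omega>"
  have \<Omega>: "open \<Omega>" "connected \<Omega>"
    using assms(1) by (auto simp: planar_domain_def)
  obtain r and \<tau> :: "complex \<Rightarrow> complex" where r: "0 < r"
      and emb: "embedding_map (top_of_set (cball 0 1)) (top_of_set (closure \<Omega>)) \<tau>"
      and \<tau>: "\<tau> ` ball 0 1 \<subseteq> \<Omega>" "ball p r \<inter> \<Omega> \<subseteq> \<tau> ` ball 0 1"
    using assms(2) p unfolding condition_1_def by blast
  have "continuous_on (cball 0 1) \<tau>" "inj_on \<tau> (cball 0 1)"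
    using homeomorphic_imp_continuous_map[OF emb[unfolded embedding_map_def]]
      homeomorphic_imp_injective_map[OF emb[unfolded embedding_map_def]]
    by (auto simp: continuous_map_in_subtopology)
  then obtain K q \<rho> where "connected K" "K \<inter> \<Omega> = {}" "0 < \<rho>" "ball p \<rho> - \<Omega> \<subseteq> K"
      "q \<notin> \<Omega>" "q \<notin> K" "q \<in> closure K"
    using connected_complement_piece_of_embedded_disc[OF \<Omega>(1) p r _ _ \<tau>] by metis
  moreover have "p \<notin> \<Omega>"
    using p \<Omega>(1) by (simp add: frontier_def interior_open)
  ultimately show "(squeezing \<Omega> \<longlongrightarrow> 1) (at p within \<Omega>)"
    using squeezing_tendsto_1_of_punctured_connected_complement \<Omega> by blast
qed

end
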